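(* Let $k\ge 1$ and let $\mathbf{s}=\{\mathbf{s}[l]\}_{l=0}^{P-1}$ be a superposition of $k$ geometric sequences, $\mathbf{s}[l]=\sum_{n=1}^{k}a_n r_n^{l}$, with $r_1,\dots,r_k\in\mathbb{C}\setminus\{0\}$ pairwise distinct and $a_1,\dots,a_k\in\mathbb{C}\setminus\{0\}$. The minimum length $P$ required to obtain $k$ is $2k+1$. That is, the smallest $P$ for which there exist $i_c\in\mathbb{N}$ (with $i_c\ge 1$) and $\phi_k=\{\phi_k[0]<\dots<\phi_k[k-1]\}\subset\mathbb{N}_0$ such that the search space formed from $\mathbf{s}$ satisfies $\mathrm{card}(\Xi_{i_c}(\phi_{k,\mathbf{s}}))>k+1$ is $P=2k+1$.
   Context: $\mathbb{N}_0=\{0\}\cup\mathbb{N}$. The search space $\Xi_{i_c}(\phi_{k,\mathbf{s}})$ is the ordered collection, over those $j=0,1,2,\dots$ for which all indices involved lie in $\{0,\dots,P-1\}$, of the vertices $$\Xi_{i_c}(\phi_{k,\mathbf{s}})[j]=\big(\mathbf{s}[\phi_k[0]+i_c j],\ \dots,\ \mathbf{s}[\phi_k[k-1]+i_c j]\big)^{\mathrm T}\in\mathbb{C}^k .$$ Its cardinality $\mathrm{card}(\cdot)$ is the number of members of this list (indexed by $j$). Criterion for obtaining $k$: the number $k$ is obtained by testing whether the signed volumes $\det([\Xi_{i_c}(\phi_{k,\mathbf{s}})[j],\dots,\Xi_{i_c}(\phi_{k,\mathbf{s}})[j+k-1]])/k!$, $j=0,1,\dots$, form a geometric sequence; the requirement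 for this to be possible is that $\mathrm{card}(\Xi_{i_c}(\phi_{k,\mathbf{s}}))$ be larger than $k+1$ (so that at least three such volumes are available). *)

theory Defs
  imports Complex_Main "Jordan_Normal_Form.Matrix"
begin

definition geometric_superposition ::
  "nat \<Rightarrow> (nat \<Rightarrow> complex) \<Rightarrow> (nat \<Rightarrow> complex) \<Rightarrow> nat \<Rightarrow> complex list" where
  "geometric_superposition k a r P = map (\<lambda>l. \<Sum>n=1..k. a n * r n ^ l) [0..<P]"

definition index_set :: "nat \<Rightarrow> nat list \<Rightarrow> bool" where
  "index_set k \<phi> \<longleftrightarrow> length \<phi> = k \<and> sorted_wrt (<) \<phi>"

(* The set of shifts j is finite whenever the step i is positive and \<phi> is nonempty;
   otherwise it may be infinite, and sorted_list_of_set then returns the empty list. *)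
definition search_space :: "nat \<Rightarrow> nat list \<Rightarrow> complex list \<Rightarrow> complex vec list" where
  "search_space i \<phi> s =
     map (\<lambda>j. vec (length \<phi>) (\<lambda>m. s ! (\<phi> ! m + i * j)))
       (sorted_list_of_set {j. \<forall>m < length \<phi>. \<phi> ! m + i * j < length s})"

(* The cardinality counts list entries, i.e. the shifts j: vertices that coincide in value
   are counted separately. With more than k + 1 vertices, at least three signed volumes of
   k consecutive vertices are available for a geometric-sequence test. *)
definition long_enough_to_obtain :: "nat \<Rightarrow> complex list \<Rightarrow> bool" where
  "long_enough_to_obtain k s \<longleftrightarrow>
     (\<exists>i \<phi>. i \<ge> 1 \<and> index_set k \<phi> \<and> length (search_space i \<phi> s) > k + 1)"

end

theory Submission
  imports Defs
begin

text \<open>Only the length of the signal matters: the cardinality counts the shifts j that keep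
  every index in range. More than k + 1 shifts force some j \<ge> k + 1; since the last index of
  \<phi> is at least k - 1 and the step at least 1, position 2k must exist
  (\<open>long_enough_imp_length\<close>). Consecutive indices with unit step attain this bound
  (\<open>long_enough_if_length\<close>).\<close>

lemma length_search_space:
  "length (search_space i \<phi> s) = card {j. \<forall>m < length \<phi>. \<phi> ! m + i * j < length s}"
  by (simp add: search_space_def)

lemma long_enough_imp_length:
  assumes "k \<ge> 1" and "long_enough_to_obtain k s"
  shows "2 * k + 1 \<le> length s"
proof -
  obtain i \<phi> where i: "i \<ge> 1" and \<phi>: "length \<phi> = k" "sorted_wrt (<) \<phi>"
    and card: "card {j. \<forall>m < k. \<phi> ! m + i * j < length s} > k + 1"
    using assms(2) by (auto simp: long_enough_to_obtain_def index_set_def length_search_space)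
  \<comment> \<open>Pigeonhole: \<open>{..k}\<close> has only k + 1 elements.\<close>
  have "\<not> {j. \<forall>m < k. \<phi> ! m + i * j < length s} \<subseteq> {..k}"
  proof
    assume "{j. \<forall>m < k. \<phi> ! m + i * j < length s} \<subseteq> {..k}"
    from card_mono[OF finite_atMost this] card show False by simp
  qed
  then obtain j where j: "\<forall>m < k. \<phi> ! m + i * j < length s" and "\<not> j \<le> k"
    by blast
  then have "k + 1 \<le> j" by simp
  \<comment> \<open>A strictly increasing list of naturals satisfies m \<le>
    \<open>\<phi> ! m\<close>.\<close>
  have "k - 1 \<le> \<phi> ! (k - 1)"
    using sorted_wrt_less_idx[OF \<phi>(2)] \<phi>(1) assms(1) by simp
  moreover have "k + 1 \<le> i * j"
    using mult_le_mono[OF i \<open>k + 1 \<le> j\<close>] by simp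
  moreover have "\<phi> ! (k - 1) + i * j < length s"
    using j assms(1) by simp
  ultimately show ?thesis by linarith
qed

text \<open>The tightest packing, \<open>[0..<k]\<close> with step 1, admits exactly the k + 2
  shifts 0, ..., k + 1.\<close>

lemma long_enough_if_length:
  assumes "k \<ge> 1" and "length s = 2 * k + 1"
  shows "long_enough_to_obtain k s"
proof -
  have "{j. \<forall>m < k. [0..<k] ! m + 1 * j < length s} = {..k + 1}"
  proof (intro equalityI subsetI)
    fix j assume "j \<in> {j. \<forall>m < k. [0..<k] ! m + 1 * j < length s}"
    then have "\<forall>m < k. m + j < length s" by simp
    \<comment> \<open>The last index is the binding one: k - 1 + j < 2k + 1 means j \<le> k +
      1.\<close>
    moreover have "k - 1 < k" using assms(1) by simp
    ultimately have "k - 1 + j < length s" by blast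
    then show "j \<in> {..k + 1}"
      using assms(2) by simp
  qed (use assms in auto)
  then have "length (search_space 1 [0..<k] s) > k + 1"
    by (simp add: length_search_space)
  then show ?thesis
    unfolding long_enough_to_obtain_def index_set_def
    by (intro exI[of _ 1] exI[of _ "[0..<k]"]) simp
qed

theorem corollary1:
  fixes k :: nat and a r :: "nat \<Rightarrow> complex"
  assumes "k \<ge> 1"
    and "inj_on r {1..k}"
    and "\<forall>n\<in>{1..k}. r n \<noteq> 0"
    and "\<forall>n\<in>{1..k}. a n \<noteq> 0"
  shows "long_enough_to_obtain k (geometric_superposition k a r (2 * k + 1)) \<and>
    (\<forall>P. long_enough_to_obtain k (geometric_superposition k a r P) \<longrightarrow> 2 * k + 1 \<le> P)"
proof -
  have "length (geometric_superposition k a r P) = P" for P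
    by (simp add: geometric_superposition_def)
  then show ?thesis
    using long_enough_if_length[OF assms(1)] long_enough_imp_length[OF assms(1)] by fastforce
qed

end
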